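(* Let $r_-\approx0.4364590141$ be the root of $69r^4+14r^2-76r+28$ in $(0.43,0.44)$ and let $r_+\approx0.4512271429$ be the root of $r^4+21r^2-14r+2$ in $(0.45,0.46)$. Let $r_-\le r\le r_+$, and let $P=\frac12P\circ S_1^{-1}+\frac12P\circ S_2^{-1}$ be the probability measure supported by the Cantor set generated by $S_1(x)=rx$ and $S_2(x)=rx+(1-r)$. Let $n\in\mathbb N$, $n\ge2$, and suppose $n$ is not of the form $2^{\ell}$ for any $\ell\in\mathbb N$. Then each set $\alpha_n(I)$ (for every admissible choice of $I$ and of the sets $A_\sigma$) forms a CVT with $n$-means for $P$.
   Context: Let $0<r<\frac12$, $S_1(x)=rx$, $S_2(x)=rx+(1-r)$ on $\mathbb R$; $P$ is the unique Borel probability measure on $\mathbb R$ with $P=\frac12P\circ S_1^{-1}+\frac12P\circ S_2^{-1}$. For a word $\sigma=\sigma_1\cdots\sigma_k\in\{1,2\}^k$ put $S_\sigma=S_{\sigma_1}\circ\cdots\circ S_{\sigma_k}$ and $J_\sigma=S_\sigma([0,1])$; $\emptyset$ is the empty word ($S_\emptyset=\mathrm{id}$, $\{1,2\}^0=\{\emptyset\}$), and $\sigma\tau$ denotes concatenation. For words $\beta,\dots,\delta$, $a(\beta,\dots,\delta)=\frac{1}{P(J_\beta\cup\cdots\cup J_\delta)}\int_{J_\beta\cup\cdots\cup J_\delta}x\,dP(x)$. For each word $\sigma$, $A_\sigma$ denotes one of the two sets (chosen arbitrarily and independently for each $\sigma$) $\{a(\sigma11,\sigma121,\sigma1221),\ a(\sigma1222,\sigma21),\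 a(\sigma22)\}$ or $\{a(\sigma11),\ a(\sigma12,\sigma2111),\ a(\sigma2112,\sigma212,\sigma22)\}$. Definition of $\alpha_n(I)$ for $n\geq 2$ not a power of $2$. Let $\ell=\ell(n)$ be the integer with $2^{\ell}<n<2^{\ell+1}$. (1) If $n=2^{\ell}+k$ with $1\le k\le2^{\ell-1}$, then $I\subseteq\{1,2\}^{\ell-1}$ with $\mathrm{card}(I)=k$ and $\alpha_n(I)=\bigcup_{\sigma\in I}A_\sigma\cup\{S_{\sigma1}(\frac12),S_{\sigma2}(\frac12):\sigma\in\{1,2\}^{\ell-1}\setminus I\}$ (so $\alpha_n(I)=\bigcup_{\sigma\in I}A_\sigma$ if $k=2^{\ell-1}$, and $\alpha_3(I)=A_\emptyset$). (2) If $n=3\cdot2^{\ell-1}+k$ with $1\le k\le2^{\ell-1}-1$, then $I\subseteq\{1,2\}^{\ell-1}$ with $\mathrm{card}(I)=k$ and $\alpha_n(I)=\bigcup_{\sigma\in\{1,2\}^{\ell-1}\setminus I}A_\sigma\cup\{S_{\sigma\tau}(\frac12):\sigma\in I,\ \tau\in\{1,2\}^2\}$. For a finite set $\alpha\subset\mathbb R$, the Voronoi region of $a\in\alpha$ is $M(a|\alpha)=\{x\in\mathbb R:|x-a|=\min_{b\in\alpha}|x-b|\}$. A set $\alpha$ of $n$ points forms a centroidal Voronoi tessellation (CVT) with $n$-means (for $P$) if for every $a\in\alpha$ we have $P(M(a|\alpha))>0$ and $a=\frac{1}{P(M(a|\alpha))}\int_{M(a|\alpha)}x\,dP(x)$.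 *)

theory Defs
  imports "HOL-Probability.Probability"
begin

definition simil :: "real \<Rightarrow> nat \<Rightarrow> real \<Rightarrow> real" where
  "simil r i x = (if i = 1 then r * x else r * x + (1 - r))"

text \<open>\<open>P = 1/2 P \<circ> S\<^sub>1\<^sup>-\<^sup>1 + 1/2 P \<circ> S\<^sub>2\<^sup>-\<^sup>1\<close>. For \<open>0 < r < 1/2\<close> exactly one measure satisfies this.\<close>

definition cantor_prob :: "real \<Rightarrow> real measure \<Rightarrow> bool" where
  "cantor_prob r P \<longleftrightarrow> prob_space P \<and> sets P = sets borel \<and>
     (\<forall>B\<in>sets borel. measure P B =
        1/2 * measure P (simil r 1 -` B) + 1/2 * measure P (simil r 2 -` B))"

definition wordset :: "nat \<Rightarrow> nat list set" where
  "wordset k = {w. length w = k \<and> set w \<subseteq> {1, 2}}"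

fun Sw :: "real \<Rightarrow> nat list \<Rightarrow> real \<Rightarrow> real" where
  "Sw r [] = id"
| "Sw r (i # w) = simil r i \<circ> Sw r w"

definition J :: "real \<Rightarrow> nat list \<Rightarrow> real set" where
  "J r w = Sw r w ` {0..1}"

definition cond_mean :: "real measure \<Rightarrow> real set \<Rightarrow> real" where
  "cond_mean P B = 1 / measure P B * (LINT x:B|P. x)"

text \<open>\<open>a(\<beta>, \<dots>, \<delta>)\<close>, the words being passed as a set.\<close>

definition aw :: "real \<Rightarrow> real measure \<Rightarrow> nat list set \<Rightarrow> real" where
  "aw r P W = cond_mean P (\<Union>w\<in>W. J r w)"

text \<open>The two candidates for \<open>A\<^sub>\<sigma>\<close>; they are exchanged by reversing the roles of the letters 1 and 2.\<close>

definition A_fst :: "real \<Rightarrow> real measure \<Rightarrow> nat list \<Rightarrow> real set" where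
  "A_fst r P s =
     {aw r P {s @ [1,1], s @ [1,2,1], s @ [1,2,2,1]},
      aw r P {s @ [1,2,2,2], s @ [2,1]},
      aw r P {s @ [2,2]}}"

definition A_snd :: "real \<Rightarrow> real measure \<Rightarrow> nat list \<Rightarrow> real set" where
  "A_snd r P s =
     {aw r P {s @ [1,1]},
      aw r P {s @ [1,2], s @ [2,1,1,1]},
      aw r P {s @ [2,1,1,2], s @ [2,1,2], s @ [2,2]}}"

definition ell :: "nat \<Rightarrow> nat" where
  "ell n = (THE l. 2 ^ l < n \<and> n < 2 ^ (l + 1))"

text \<open>
  For \<open>n \<ge> 2\<close> not a power of 2 we have \<open>ell n \<ge> 1\<close>, so the truncated subtraction
  \<open>ell n - 1\<close> is exact. The case \<open>n = 2^ell + k\<close>, \<open>1 \<le> k \<le> 2^(ell-1)\<close>, is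
  \<open>n \<le> 3 * 2^(ell-1)\<close>; the case \<open>n = 3 * 2^(ell-1) + k\<close>, \<open>1 \<le> k \<le> 2^(ell-1) - 1\<close>,
  is the remaining one.
\<close>

definition admissible :: "nat \<Rightarrow> nat list set \<Rightarrow> bool" where
  "admissible n I \<longleftrightarrow> I \<subseteq> wordset (ell n - 1) \<and>
     card I = (if n \<le> 3 * 2 ^ (ell n - 1) then n - 2 ^ ell n else n - 3 * 2 ^ (ell n - 1))"

text \<open>The family \<open>A\<close> records the choice of \<open>A\<^sub>\<sigma>\<close> for every word \<open>\<sigma>\<close>.\<close>

definition alpha :: "real \<Rightarrow> (nat list \<Rightarrow> real set) \<Rightarrow> nat \<Rightarrow> nat list set \<Rightarrow> real set" where
  "alpha r A n I =
     (if n \<le> 3 * 2 ^ (ell n - 1)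
      then (\<Union>s\<in>I. A s) \<union>
           (\<Union>s \<in> wordset (ell n - 1) - I. {Sw r (s @ [1]) (1/2), Sw r (s @ [2]) (1/2)})
      else (\<Union>s \<in> wordset (ell n - 1) - I. A s) \<union>
           {Sw r (s @ t) (1/2) | s t. s \<in> I \<and> t \<in> wordset 2})"

definition voronoi :: "real set \<Rightarrow> real \<Rightarrow> real set" where
  "voronoi \<alpha> a = {x. \<bar>x - a\<bar> = Min ((\<lambda>b. \<bar>x - b\<bar>) ` \<alpha>)}"

definition CVT :: "real measure \<Rightarrow> nat \<Rightarrow> real set \<Rightarrow> bool" where
  "CVT P n \<alpha> \<longleftrightarrow> finite \<alpha> \<and> card \<alpha> = n \<and>
     (\<forall>a\<in>\<alpha>. measure P (voronoi \<alpha> a) > 0 \<and> a = cond_mean P (voronoi \<alpha> a))"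

end

theory Submission
  imports Defs "HOL-Library.Sublist"
begin

text \<open>
  The measure \<open>P\<close> gives each basic interval \<open>J r w\<close> the mass \<open>2 ^ (- length w)\<close> and the centroid
  \<open>Sw r w (1/2)\<close> (\<open>measure_J\<close>, \<open>integral_J\<close>), and it has no atoms (\<open>measure_singleton\<close>). So the centroid of
  a finite union of disjoint basic intervals is an explicit polynomial in \<open>r\<close>, and every point of
  \<open>alpha r A n I\<close> is the centroid of such a union, its cell. These cells carry all the mass. It remains
  to see that the Voronoi region of a point agrees with its cell up to a null set. This holds as soon as
  for any two points the midpoint separates the two cells
  (\<open>CVT_of_separated_cells\<close>).

  Each word \<open>s\<close> of length \<open>ell n - 1\<close> gives a block \<open>J r s\<close>, which contains two, three or four points
  in one of four configurations, each a scaled copy of a configuration in the unit interval. Midpoints of two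
  points of the same block are therefore a matter of a finite computation in the unit interval. In it,
  the two polynomials that define the range of \<open>r\<close> appear: their signs say that the two inner
  midpoints of a configuration of three points do not enter the adjacent cells
  (\<open>configurations\<close>). For points in different blocks, the gap between blocks is so large compared
  with the position of the points in their blocks that the midpoint separates
  the cells for any combination of configurations (\<open>confined_separated\<close>). This is why the set \<open>I\<close> and
  the choice of each \<open>A s\<close> are arbitrary (\<open>CVT_of_configurations\<close>).
\<close>

section \<open>Similarities and basic intervals\<close>

lemma simil_alt: "simil r i x = r * x + (if i = 1 then 0 else 1 - r)"
  by (simp add: simil_def)

lemma Sw_append: "Sw r (s @ t) x = Sw r s (Sw r t x)"
  by (induction s) auto

lemma Sw_affine: "Sw r w x = r ^ length w * x + Sw r w 0"
proof (induction w arbitrary: x)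
  case (Cons i w)
  show ?case
    using Cons[of x] by (simp add: simil_alt algebra_simps)
qed simp

lemma J_append: "J r (s @ t) = Sw r s ` J r t"
  by (auto simp: J_def Sw_append image_image)

context
  fixes r :: real
  assumes r: "0 < r" "r < 1/2"
begin

lemma Sw_mono_iff: "Sw r w x \<le> Sw r w y \<longleftrightarrow> x \<le> y"
  by (subst (1 2) Sw_affine) (simp add: r)

lemma Sw_bounds: "0 \<le> x \<Longrightarrow> x \<le> 1 \<Longrightarrow> 0 \<le> Sw r w x \<and> Sw r w x \<le> 1"
proof (induction w)
  case (Cons i w)
  then have "0 \<le> r * Sw r w x" "r * Sw r w x \<le> r"
    using r by (auto simp: mult_left_le)
  moreover have "simil r i (Sw r w x) = r * Sw r w x \<or> simil r i (Sw r w x) = r * Sw r w x + (1 - r)"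
    by (simp add: simil_def)
  ultimately have "0 \<le> simil r i (Sw r w x) \<and> simil r i (Sw r w x) \<le> 1"
    using r by linarith
  then show ?case by simp
qed simp

lemma J_eq_interval: "J r w = {Sw r w 0..Sw r w 1}"
proof (intro set_eqI iffI)
  fix x assume x: "x \<in> {Sw r w 0..Sw r w 1}"
  define y where "y = (x - Sw r w 0) / r ^ length w"
  have "x = Sw r w y"
    using r by (subst Sw_affine) (simp add: y_def)
  moreover from this x have "y \<in> {0..1}"
    by (simp add: Sw_mono_iff)
  ultimately show "x \<in> J r w" by (auto simp: J_def)
qed (auto simp: J_def Sw_mono_iff)

lemma J_borel [measurable]: "J r w \<in> sets borel"
  by (simp add: J_eq_interval)

lemma J_subset_unit: "J r w \<subseteq> {0..1}"
  unfolding J_def using Sw_bounds by fastforce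

text \<open>Two words of equal length \<open>k\<close> over \<open>{1, 2}\<close> first differ after a common prefix of some length
  \<open>j < k\<close>. The gap that the construction leaves open there has length \<open>(1 - 2r) r ^ j\<close>, hence at least
  \<open>(1 - 2r) r ^ (k - 1)\<close>. Adding the length \<open>r ^ k\<close> of the left one of the two intervals gives
  \<open>r ^ k (1 - r) / r\<close> as a lower bound for the distance of the left endpoints.\<close>

lemma basic_interval_gap:
  assumes "length s = length t" "set s \<subseteq> {1, 2}" "set t \<subseteq> {1, 2}" "s \<noteq> t"
  shows "Sw r s 0 + r ^ length s * ((1 - r) / r) \<le> Sw r t 0 \<or>
         Sw r t 0 + r ^ length s * ((1 - r) / r) \<le> Sw r s 0"
  using assms
proof (induction s t rule: list_induct2)
  case (Cons i s j t)
  show ?case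
  proof (cases "i = j")
    case True
    have scale: "simil r i x + r ^ length (i # s) * c \<le> simil r i y" if "x + r ^ length s * c \<le> y"
      for x y c
    proof -
      have "r * (x + r ^ length s * c) \<le> r * y"
        using that r by (intro mult_left_mono) auto
      then show ?thesis by (simp add: simil_alt algebra_simps)
    qed
    have "Sw r s 0 + r ^ length s * ((1 - r) / r) \<le> Sw r t 0 \<or>
         Sw r t 0 + r ^ length s * ((1 - r) / r) \<le> Sw r s 0"
      using Cons True by auto
    then show ?thesis using True scale by fastforce
  next
    case False
    \<comment> \<open>The interval of the word starting with 1 ends before \<open>r\<close>, and its diameter is
      at most \<open>r\<close>; the other one starts after \<open>1 - r\<close>.\<close>
    have left: "simil r 1 (Sw r u 0) + r ^ Suc (length u) * ((1 - r) / r) \<le> simil r 2 (Sw r v 0)" for u v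
    proof -
      have "Sw r u 0 + r ^ length u \<le> 1"
        using Sw_bounds[of 1 u] Sw_affine[of r u 1] by simp
      then have "r * Sw r u 0 \<le> r * (1 - r ^ length u)"
        using r by (intro mult_left_mono) auto
      moreover have "0 \<le> Sw r v 0" using Sw_bounds[of 0 v] by simp
      then have "0 \<le> r * Sw r v 0" using r by simp
      moreover have "r ^ length u * (1 - 2 * r) \<le> 1 * (1 - 2 * r)"
        using r by (intro mult_right_mono power_le_one) auto
      moreover have "r ^ Suc (length u) * ((1 - r) / r) = r ^ length u - r * r ^ length u"
        using r by (simp add: field_simps)
      ultimately show ?thesis
        unfolding simil_alt by (simp add: algebra_simps)
    qed
    have ij: "i = 1 \<and> j = 2 \<or> i = 2 \<and> j = 1"
      using False Cons.prems by auto
    show ?thesis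
      using ij left[of s t] left[of t s] Cons.hyps by auto
  qed
qed simp

lemma J_disjoint:
  assumes "u \<parallel> w" "set u \<subseteq> {1, 2}" "set w \<subseteq> {1, 2}"
  shows "J r u \<inter> J r w = {}"
proof -
  obtain c i u' j w' where uw: "i \<noteq> j" "u = c @ i # u'" "w = c @ j # w'"
    using parallel_decomp[OF assms(1)] by blast
  have ij: "i = 1 \<and> j = 2 \<or> i = 2 \<and> j = 1"
    using uw assms by auto
  have J1: "J r (1 # v) \<subseteq> {..r}" for v
  proof
    fix x assume "x \<in> J r (1 # v)"
    then obtain y where y: "x = r * Sw r v y" "0 \<le> y" "y \<le> 1"
      by (auto simp: J_def simil_def intro: that)
    then show "x \<in> {..r}" using Sw_bounds[of y v] r by (simp add: mult_left_le)
  qed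
  have J2: "J r (2 # v) \<subseteq> {1 - r..}" for v
  proof
    fix x assume "x \<in> J r (2 # v)"
    then obtain y where y: "x = r * Sw r v y + (1 - r)" "0 \<le> y" "y \<le> 1"
      by (auto simp: J_def simil_def intro: that)
    then show "x \<in> {1 - r..}" using Sw_bounds[of y v] r by simp
  qed
  have "{..r} \<inter> {1 - r..} = {}" using r by auto
  then have "J r (i # u') \<inter> J r (j # w') = {}"
    using ij J1[of u'] J1[of w'] J2[of u'] J2[of w'] by auto
  moreover have "inj (Sw r c)"
    by (metis Sw_mono_iff antisym injI order_refl)
  ultimately show ?thesis
    unfolding uw J_append by (metis image_Int image_empty)
qed

end

section \<open>The self-similar measure\<close>

locale cantor_measure =
  fixes r :: real and P :: "real measure"
  assumes r: "0 < r" "r < 1/2" and cantor: "cantor_prob r P"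
begin

sublocale prob_space P
  using cantor by (simp add: cantor_prob_def)

lemma sets_P [simp, measurable_cong]: "sets P = sets borel"
  using cantor by (simp add: cantor_prob_def)

lemma space_P [simp]: "space P = UNIV"
  using sets_eq_imp_space_eq[OF sets_P] by simp

lemma measure_selfsimilar:
  assumes "B \<in> sets borel"
  shows "measure P B = (measure P (simil r 1 -` B) + measure P (simil r 2 -` B)) / 2"
  using cantor assms by (simp add: cantor_prob_def)

lemma simil_measurable [measurable]: "simil r i \<in> borel_measurable borel"
  unfolding simil_def by measurable

lemma vimage_borel: "B \<in> sets borel \<Longrightarrow> simil r i -` B \<in> sets borel"
  using measurable_sets[OF simil_measurable] by fastforce

text \<open>Both preimages of the set of points at distance more than \<open>t\<close> from \<open>[0, 1]\<close> lie at distance more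
  than \<open>t / r\<close>. Iterating pushes the mass of this set off to infinity.\<close>

lemma measure_far_eq_0:
  assumes t: "0 < t"
  shows "measure P (- {- t..1 + t}) = 0"
proof -
  define T where "T t = - {- t..1 + t}" for t :: real
  have T_borel: "T t \<in> sets borel" for t by (simp add: T_def)
  have step: "measure P (T t) \<le> measure P (T (t / r))" if "0 < t" for t
  proof -
    have sub: "simil r i -` T t \<subseteq> T (t / r)" for i
      using r that by (auto simp: T_def simil_alt field_simps split: if_splits)
    have "measure P (simil r i -` T t) \<le> measure P (T (t / r))" for i
      by (intro finite_measure_mono sub) (simp add: T_borel)
    from this[of 1] this[of 2] show ?thesis
      by (simp add: measure_selfsimilar[OF T_borel])
  qed
  have le: "measure P (T t) \<le> measure P (T (t / r ^ n))" for n
  proof (induction n)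
    case (Suc n)
    have "t / r ^ n / r = t / r ^ Suc n" by simp
    then show ?case using Suc step[of "t / r ^ n"] t r by (metis order_trans zero_less_divide_iff zero_less_power)
  qed simp
  have "(\<lambda>n. measure P (T (t / r ^ n))) \<longlonglongrightarrow> measure P (\<Inter>n. T (t / r ^ n))"
  proof (rule finite_Lim_measure_decseq)
    show "decseq (\<lambda>n. T (t / r ^ n))"
    proof (rule decseq_SucI)
      fix n
      have "t / r ^ n \<le> t / r ^ Suc n"
        using t r by (intro divide_left_mono) (auto simp: mult_le_cancel_right1)
      then show "T (t / r ^ Suc n) \<subseteq> T (t / r ^ n)" by (auto simp: T_def)
    qed
  qed (auto simp: T_borel)
  moreover have "(\<Inter>n. T (t / r ^ n)) = {}"
  proof -
    have "\<exists>n. x \<notin> T (t / r ^ n)" for x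
    proof -
      obtain n where n: "r ^ n < t / (\<bar>x\<bar> + 1)"
        using real_arch_pow_inv[of "t / (\<bar>x\<bar> + 1)" r] t r by (auto simp: add_nonneg_pos)
      then have "(\<bar>x\<bar> + 1) * r ^ n < t"
        by (simp add: pos_less_divide_eq add_nonneg_pos mult.commute)
      then have "\<bar>x\<bar> + 1 < t / r ^ n"
        using r by (simp add: pos_less_divide_eq)
      then have "x \<notin> T (t / r ^ n)" unfolding T_def by auto
      then show ?thesis ..
    qed
    then show ?thesis by blast
  qed
  ultimately have "measure P (T t) \<le> 0"
    using le by (intro LIMSEQ_le_const[of "\<lambda>n. measure P (T (t / r ^ n))"]) auto
  then show ?thesis by (simp add: T_def measure_le_0_iff)
qed

lemma measure_off_unit: "measure P (- {0..1}) = 0"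
proof -
  have "- {0..1::real} = (\<Union>n. - {- inverse (real (Suc n))..1 + inverse (real (Suc n))})"
  proof (intro set_eqI iffI)
    fix x :: real assume x: "x \<in> - {0..1}"
    then have "0 < max (- x) (x - 1)" by auto
    then obtain n where "inverse (real (Suc n)) < max (- x) (x - 1)"
      using reals_Archimedean by blast
    then show "x \<in> (\<Union>n. - {- inverse (real (Suc n))..1 + inverse (real (Suc n))})"
      by (intro UN_I[of n]) auto
  next
    fix x :: real assume "x \<in> (\<Union>n. - {- inverse (real (Suc n))..1 + inverse (real (Suc n))})"
    then obtain n where "x < - inverse (real (Suc n)) \<or> x > 1 + inverse (real (Suc n))"
      unfolding UN_iff Compl_iff atLeastAtMost_iff not_le de_Morgan_conj by blast
    moreover have "0 < inverse (real (Suc n))" by simp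
    ultimately have "x < 0 \<or> 1 < x" by linarith
    then show "x \<in> - {0..1}" by auto
  qed
  also have "measure P \<dots> = 0"
    by (intro measure_eq_0_null_sets null_sets_UN)
      (simp add: null_sets_def emeasure_eq_measure measure_far_eq_0 del: of_nat_Suc)
  finally show ?thesis .
qed

lemma measure_disjoint_unit:
  assumes "B \<in> sets borel" "B \<inter> {0..1} = {}"
  shows "measure P B = 0"
proof -
  have "measure P B \<le> measure P (- {0..1})"
    using assms by (intro finite_measure_mono) auto
  then show ?thesis by (simp add: measure_off_unit measure_le_0_iff)
qed

text \<open>At most one of the two preimages of a point meets \<open>[0, 1]\<close>, so each level of the
  construction halves the largest possible mass of a point.\<close>

lemma measure_singleton: "measure P {x} = 0"
proof -
  have pre: "simil r 1 -` {x} = {x / r}" "simil r 2 -` {x} = {(x - (1 - r)) / r}" for x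
    using r by (auto simp: simil_def field_simps)
  have le: "measure P {x} \<le> (1/2) ^ n" for n x
  proof (induction n arbitrary: x)
    case (Suc n)
    have "x / r > 1 \<or> (x - (1 - r)) / r < 0"
      using r by (auto simp: field_simps)
    then have "measure P {x / r} = 0 \<or> measure P {(x - (1 - r)) / r} = 0"
      using measure_disjoint_unit[of "{x / r}"] measure_disjoint_unit[of "{(x - (1 - r)) / r}"] by auto
    then have "(measure P {x / r} + measure P {(x - (1 - r)) / r}) / 2 \<le> (1/2) ^ Suc n"
      using Suc[of "x / r"] Suc[of "(x - (1 - r)) / r"] by auto
    then show ?case
      by (subst measure_selfsimilar) (simp_all only: pre borel_singleton sets.empty_sets)
  qed simp
  have "(\<lambda>n. (1/2 :: real) ^ n) \<longlonglongrightarrow> 0"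
    by (simp add: LIMSEQ_realpow_zero)
  then have "measure P {x} \<le> 0"
    using le by (intro LIMSEQ_le_const[of "\<lambda>n. (1/2 :: real) ^ n"]) auto
  then show ?thesis by (simp add: measure_le_0_iff)
qed

lemma J_borel' [measurable]: "J r w \<in> sets borel"
  by (rule J_borel[OF r])

text \<open>Of the two preimages of \<open>J r (i # w)\<close>, the one under the map \<open>simil r i\<close> is \<open>J r w\<close>, and the other one
  misses \<open>[0, 1]\<close> and so carries no mass.\<close>

lemma measure_J:
  assumes "set w \<subseteq> {1, 2}"
  shows "measure P (J r w) = (1/2) ^ length w"
  using assms
proof (induction w)
  case Nil
  have "measure P {0..1} = 1"
    using prob_compl[of "{0..1}"] measure_off_unit by (simp add: Compl_eq_Diff_UNIV)
  then show ?case by (simp add: J_def)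
next
  case (Cons i w)
  have i: "i = 1 \<or> i = 2" using Cons by auto
  have image: "J r (i # w) = simil r i ` J r w"
    by (simp add: J_def image_comp)
  have "inj (simil r i)" using r by (auto simp: inj_def simil_def)
  then have same: "simil r i -` J r (i # w) = J r w"
    unfolding image by (rule inj_vimage_image_eq)
  have other: "simil r (3 - i) -` J r (i # w) \<inter> {0..1} = {}"
  proof -
    have False if "y \<in> {0..1}" and "simil r (3 - i) y = simil r i x" and "x \<in> J r w" for x y
    proof -
      have "x \<in> {0..1}" using that J_subset_unit[OF r] by blast
      moreover have "r * x \<ge> 0" "r * x \<le> r" if "x \<in> {0..1}" for x
        using that r by (auto simp: mult_left_le)
      ultimately have "r * y \<ge> 0" "r * x \<ge> 0" "r * y \<le> r" "r * x \<le> r"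
        using that(1) by blast+
      then have "r * y + (1 - r) \<noteq> r * x" "r * x + (1 - r) \<noteq> r * y"
        using r by linarith+
      then show False using i that(2) by (auto simp: simil_alt)
    qed
    then show ?thesis unfolding image by blast
  qed
  have "measure P (simil r (3 - i) -` J r (i # w)) = 0"
    using other by (intro measure_disjoint_unit vimage_borel) auto
  then show ?case
    using i Cons same by (auto simp: measure_selfsimilar[of "J r (i # w)"])
qed

lemma set_integrable_unit:
  assumes "B \<in> sets borel" "B \<subseteq> {0..1}"
  shows "set_integrable P B (\<lambda>x. x)"
  unfolding set_integrable_def
proof (rule integrable_const_bound)
  have "norm (indicator B x *\<^sub>R x) \<le> 1" for x :: real
    using assms(2) by (cases "x \<in> B") auto
  then show "AE x in P. norm (indicator B x *\<^sub>R x) \<le> 1" by simp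
qed (use assms in measurable)

lemma set_integral_eq_of_subset_same_measure:
  assumes "A \<in> sets borel" "B \<in> sets borel" "A \<subseteq> B" "measure P A = measure P B"
  shows "(LINT x:B|P. x) = (LINT x:A|P. x)"
proof -
  have "measure P (B - A) = 0"
    using assms by (simp add: finite_measure_Diff)
  then have "B - A \<in> null_sets P"
    using assms by (auto simp: null_sets_def emeasure_eq_measure)
  then have "AE x in P. x \<notin> B - A" by (rule AE_not_in)
  then have "AE x in P. x \<in> A \<longleftrightarrow> x \<in> B"
    by (rule AE_mp) (use assms(3) in \<open>auto intro!: AE_I2\<close>)
  then show ?thesis
    using assms by (intro set_integral_cong_set) (auto simp: set_borel_measurable_def)
qed

text \<open>Let \<open>e w\<close> be the integral over \<open>J r w\<close> minus the value that it would have if all mass of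
  \<open>J r w\<close> sat at its midpoint. The midpoint of \<open>J r w\<close> is the average of the midpoints of its two equally heavy
  children, so \<open>e\<close> is additive over children; and \<open>\<bar>e w\<bar>\<close> is at most mass times
  diameter. Summing over all descendants at depth \<open>n\<close> gives a bound of order \<open>r ^ n\<close>.\<close>

lemma integral_J:
  assumes "set w \<subseteq> {1, 2}"
  shows "(LINT x:J r w|P. x) = (1/2) ^ length w * Sw r w (1/2)"
proof -
  define e where "e w = (LINT x:J r w|P. x) - (1/2) ^ length w * Sw r w (1/2)" for w
  have bound: "\<bar>e w\<bar> \<le> r ^ (length w + n) * (1/2) ^ length w" if "set w \<subseteq> {1, 2}" for n w
    using that
  proof (induction n arbitrary: w)
    case 0
    have const: "(LINT x:J r w|P. c) = (1/2) ^ length w * c" for c :: real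
      using measure_J[OF 0] by (subst set_integral_const) (auto simp: less_top[symmetric])
    have int: "set_integrable P (J r w) (\<lambda>x. x)" "set_integrable P (J r w) (\<lambda>x. c)" for c :: real
      by (intro set_integrable_unit J_borel' J_subset_unit[OF r])
        (simp add: set_integrable_def less_top[symmetric])
    have "(LINT x:J r w|P. Sw r w 0) \<le> (LINT x:J r w|P. x)"
      by (intro set_integral_mono int) (auto simp: J_eq_interval[OF r])
    moreover have "(LINT x:J r w|P. x) \<le> (LINT x:J r w|P. Sw r w 1)"
      by (intro set_integral_mono int) (auto simp: J_eq_interval[OF r])
    moreover have "Sw r w 1 = r ^ length w + Sw r w 0" "Sw r w (1/2) = r ^ length w * (1/2) + Sw r w 0"
      by (subst Sw_affine, simp)+
    ultimately have "\<bar>e w\<bar> \<le> (1/2) ^ length w * r ^ length w"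
      using r unfolding e_def const by (simp add: abs_le_iff algebra_simps)
    then show ?case by (simp add: mult.commute)
  next
    case (Suc n)
    let ?A = "J r (w @ [1])" and ?B = "J r (w @ [2])"
    have disj: "?A \<inter> ?B = {}"
      using Suc by (intro J_disjoint[OF r]) (auto simp: parallel_def)
    have sub: "?A \<union> ?B \<subseteq> J r w"
      using J_subset_unit[OF r, of "[1]"] J_subset_unit[OF r, of "[2]"]
      by (simp add: J_append) (auto simp: J_def)
    have "measure P (?A \<union> ?B) = measure P (J r w)"
      using Suc disj by (simp add: finite_measure_Union measure_J)
    then have "(LINT x:J r w|P. x) = (LINT x:?A \<union> ?B|P. x)"
      using sub by (intro set_integral_eq_of_subset_same_measure) auto
    also have "\<dots> = (LINT x:?A|P. x) + (LINT x:?B|P. x)"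
      using J_subset_unit[OF r] disj by (intro set_integral_Un set_integrable_unit) auto
    finally have "e w = e (w @ [1]) + e (w @ [2])"
      unfolding e_def Sw_append
      by (subst Sw_affine[of r w "Sw r [1] (1/2)"], subst Sw_affine[of r w "Sw r [2] (1/2)"],
          subst Sw_affine[of r w "1/2"]) (simp add: simil_alt field_simps)
    then have "\<bar>e w\<bar> \<le> \<bar>e (w @ [1])\<bar> + \<bar>e (w @ [2])\<bar>" by simp
    also have "\<dots> \<le> r ^ (length w + Suc n) * (1/2) ^ length w"
      using Suc.IH[of "w @ [1]"] Suc.IH[of "w @ [2]"] Suc.prems by simp
    finally show ?case .
  qed
  have "(\<lambda>n. r ^ n * (r ^ length w * (1/2) ^ length w)) \<longlonglongrightarrow> 0 * (r ^ length w * (1/2) ^ length w)"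
    using r by (intro tendsto_mult tendsto_const LIMSEQ_realpow_zero) auto
  then have "(\<lambda>n. r ^ (length w + n) * (1/2) ^ length w) \<longlonglongrightarrow> 0"
    by (simp add: power_add mult_ac)
  then have "\<bar>e w\<bar> \<le> 0"
    using bound[OF assms] by (intro LIMSEQ_le_const[of "\<lambda>n. r ^ (length w + n) * (1/2) ^ length w"]) auto
  then show ?thesis by (simp add: e_def)
qed

end

section \<open>Voronoi partitions from separated cells\<close>

text \<open>The cells \<open>C\<close> of \<open>p\<close> and \<open>D\<close> of \<open>q\<close> may touch the midpoint of \<open>p\<close> and \<open>q\<close>, because this happens at the two
  extreme values of \<open>r\<close>.\<close>

definition separated :: "real \<Rightarrow> real set \<Rightarrow> real \<Rightarrow> real set \<Rightarrow> bool" where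
  "separated p C q D \<longleftrightarrow> p < q \<and> (\<forall>x\<in>C. 2 * x \<le> p + q) \<and> (\<forall>y\<in>D. p + q \<le> 2 * y)"

lemma separated_affine:
  assumes "separated p C q D" "0 < c" "\<And>x. f x = c * x + d"
  shows "separated (f p) (f ` C) (f q) (f ` D)"
proof -
  have "c * (2 * x) \<le> c * (p + q)" if "x \<in> C" for x
    using assms that by (intro mult_left_mono) (auto simp: separated_def)
  moreover have "c * (p + q) \<le> c * (2 * y)" if "y \<in> D" for y
    using assms that by (intro mult_left_mono) (auto simp: separated_def)
  moreover have "c * p < c * q" using assms by (simp add: separated_def)
  ultimately show ?thesis
    unfolding separated_def assms(3) by (force simp: assms(3) algebra_simps)
qed

text \<open>Separation puts each cell inside the Voronoi region of its point. Conversely, a region meets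
  another cell at most in the midpoint of the two points. As the cells carry all mass and points
  carry none, region and cell agree up to a null set, and being the centroid of
  one means being the centroid of the other.\<close>

lemma (in cantor_measure) CVT_of_separated_cells:
  assumes fin: "finite K"
    and cells: "\<And>i. i \<in> K \<Longrightarrow> C i \<in> sets borel" "\<And>i. i \<in> K \<Longrightarrow> 0 < measure P (C i)"
      "\<And>i. i \<in> K \<Longrightarrow> a i = cond_mean P (C i)"
    and total: "measure P (\<Union>i\<in>K. C i) = 1"
    and sep: "\<And>i j. i \<in> K \<Longrightarrow> j \<in> K \<Longrightarrow> i \<noteq> j \<Longrightarrow>
      separated (a i) (C i) (a j) (C j) \<or> separated (a j) (C j) (a i) (C i)"
  shows "CVT P (card K) (a ` K)"
proof -
  have inj: "inj_on a K"
    using sep by (force simp: inj_on_def separated_def)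
  have vor: "x \<in> voronoi (a ` K) (a i) \<longleftrightarrow> (\<forall>j\<in>K. \<bar>x - a i\<bar> \<le> \<bar>x - a j\<bar>)" if "i \<in> K" for i x
  proof -
    have "x \<in> voronoi (a ` K) (a i) \<longleftrightarrow> Min ((\<lambda>b. \<bar>x - b\<bar>) ` a ` K) = \<bar>x - a i\<bar>"
      by (auto simp: voronoi_def)
    also have "\<dots> \<longleftrightarrow> (\<forall>j\<in>K. \<bar>x - a i\<bar> \<le> \<bar>x - a j\<bar>)"
      using fin that by (subst Min_eq_iff) auto
    finally show ?thesis .
  qed
  have vor_borel: "voronoi (a ` K) (a i) \<in> sets borel" if "i \<in> K" for i
  proof -
    have "voronoi (a ` K) (a i) = (\<Inter>j\<in>K. {x. \<bar>x - a i\<bar> \<le> \<bar>x - a j\<bar>})"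
      using vor[OF that] by auto
    also have "\<dots> \<in> sets borel"
      using fin that by (intro sets.finite_INT) auto
    finally show ?thesis .
  qed
  have ae: "AE x in P. x \<in> voronoi (a ` K) (a i) \<longleftrightarrow> x \<in> C i" if i: "i \<in> K" for i
  proof -
    have "AE x in P. x \<in> (\<Union>i\<in>K. C i)"
      using total fin cells by (subst prob_eq_1[symmetric]) (auto simp: measure_def)
    moreover have "AE x in P. x \<noteq> (a i + a j) / 2" if "j \<in> K" for j
      using measure_singleton[of "(a i + a j) / 2"]
      by (intro AE_I[where N = "{(a i + a j) / 2}"]) (auto simp: emeasure_eq_measure)
    then have "AE x in P. \<forall>j\<in>K. x \<noteq> (a i + a j) / 2"
      using fin by (subst AE_finite_all) auto
    ultimately show ?thesis
    proof eventually_elim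
      case (elim x)
      then obtain k where k: "k \<in> K" "x \<in> C k" by auto
      show ?case
      proof
        assume "x \<in> C i"
        then show "x \<in> voronoi (a ` K) (a i)"
          unfolding vor[OF i] using sep[OF i] by (fastforce simp: separated_def)
      next
        assume x: "x \<in> voronoi (a ` K) (a i)"
        have "k = i"
        proof (rule ccontr)
          assume "k \<noteq> i"
          then have "2 * x = a i + a k"
            using sep[OF i k(1)] k(2) x k(1) unfolding vor[OF i] separated_def by (smt (verit))
          then show False using elim(2) k(1) by auto
        qed
        then show "x \<in> C i" using k by simp
      qed
    qed
  qed
  have "measure P (voronoi (a ` K) (a i)) = measure P (C i)" if "i \<in> K" for i
    using ae[OF that] vor_borel[OF that] cells(1)[OF that] by (intro finite_measure_eq_AE) auto
  moreover have "(LINT x:voronoi (a ` K) (a i)|P. x) = (LINT x:C i|P. x)" if "i \<in> K" for i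
    using ae[OF that] vor_borel[OF that] cells(1)[OF that]
    by (intro set_integral_cong_set) (auto simp: set_borel_measurable_def eq_commute)
  ultimately have "cond_mean P (voronoi (a ` K) (a i)) = a i"
    "measure P (voronoi (a ` K) (a i)) > 0" if "i \<in> K" for i
    using cells that by (auto simp: cond_mean_def)
  then show ?thesis
    unfolding CVT_def using fin card_image[OF inj] by auto
qed

section \<open>Cells made of basic intervals\<close>

definition cell :: "real \<Rightarrow> nat list list \<Rightarrow> real set" where
  "cell r W = (\<Union>w\<in>set W. J r w)"

definition weight :: "nat list list \<Rightarrow> real" where
  "weight W = (\<Sum>w\<leftarrow>W. (1/2) ^ length w)"

definition centroid :: "real \<Rightarrow> nat list list \<Rightarrow> real" where
  "centroid r W = (\<Sum>w\<leftarrow>W. (1/2) ^ length w * Sw r w (1/2)) / weight W"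

text \<open>Words over \<open>{1, 2}\<close> are incomparable in the prefix order exactly if their basic intervals do not overlap.\<close>

definition disjoint_words :: "nat list list \<Rightarrow> bool" where
  "disjoint_words W \<longleftrightarrow> sorted_wrt (\<parallel>) W \<and> (\<forall>w\<in>set W. set w \<subseteq> {1, 2})"

lemma weight_pos: "W \<noteq> [] \<Longrightarrow> 0 < weight W"
  unfolding weight_def by (cases W) (auto intro!: add_pos_nonneg sum_list_nonneg)

lemma weight_shift: "weight (map ((@) s) W) = (1/2) ^ length s * weight W"
  by (simp add: weight_def sum_list_const_mult[symmetric] o_def power_add)

lemma cell_shift: "cell r (map ((@) s) W) = Sw r s ` cell r W"
  by (simp add: cell_def J_append image_UN)

lemma centroid_shift:
  assumes "W \<noteq> []"
  shows "centroid r (map ((@) s) W) = Sw r s (centroid r W)"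
proof -
  have "(\<Sum>w\<leftarrow>map ((@) s) W. (1/2) ^ length w * Sw r w (1/2))
      = (1/2) ^ length s * (r ^ length s * (\<Sum>w\<leftarrow>W. (1/2) ^ length w * Sw r w (1/2)) + Sw r s 0 * weight W)"
  proof (induction W)
    case (Cons w W)
    then show ?case
      by (simp add: Sw_append Sw_affine[of r s "Sw r w (1/2)"] weight_def power_add algebra_simps)
  qed (simp add: weight_def)
  then have "centroid r (map ((@) s) W)
      = r ^ length s * centroid r W + Sw r s 0"
    using weight_pos[OF assms] by (simp add: centroid_def weight_shift field_simps)
  then show ?thesis by (subst Sw_affine)
qed

lemma disjoint_words_shift:
  assumes "disjoint_words W" "set s \<subseteq> {1, 2}"
  shows "disjoint_words (map ((@) s) W)"
  using assms by (induction W) (auto simp: disjoint_words_def parallel_def)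

context cantor_measure
begin

lemma cell_borel [measurable]: "cell r W \<in> sets borel"
  unfolding cell_def by (intro sets.finite_UN) auto

lemma cell_subset_unit: "cell r W \<subseteq> {0..1}"
  unfolding cell_def using J_subset_unit[OF r] by blast

lemma cell_moments:
  assumes "disjoint_words W"
  shows "measure P (cell r W) = weight W \<and>
    (LINT x:cell r W|P. x) = (\<Sum>w\<leftarrow>W. (1/2) ^ length w * Sw r w (1/2))"
  using assms
proof (induction W)
  case (Cons w W)
  have w: "set w \<subseteq> {1, 2}" and W: "disjoint_words W"
    using Cons.prems by (auto simp: disjoint_words_def)
  have "J r w \<inter> J r v = {}" if "v \<in> set W" for v
    using Cons.prems that by (intro J_disjoint[OF r]) (auto simp: disjoint_words_def)
  then have disj: "J r w \<inter> cell r W = {}"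
    by (auto simp: cell_def)
  have split: "cell r (w # W) = J r w \<union> cell r W"
    by (simp add: cell_def)
  have "measure P (J r w \<union> cell r W) = measure P (J r w) + measure P (cell r W)"
    using disj by (simp add: finite_measure_Union)
  moreover have "(LINT x:J r w \<union> cell r W|P. x) = (LINT x:J r w|P. x) + (LINT x:cell r W|P. x)"
    using J_subset_unit[OF r] cell_subset_unit
    by (intro set_integral_Un set_integrable_unit disj) auto
  ultimately show ?case
    using Cons.IH[OF W] measure_J[OF w] integral_J[OF w] by (simp add: split weight_def)
qed (simp_all add: cell_def weight_def set_lebesgue_integral_def)

lemma cond_mean_cell: "disjoint_words W \<Longrightarrow> cond_mean P (cell r W) = centroid r W"
  by (simp add: cond_mean_def cell_moments centroid_def)

lemma aw_eq_centroid: "disjoint_words W \<Longrightarrow> aw r P (set W) = centroid r W"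
  by (simp add: aw_def cond_mean_cell[symmetric] cell_def)

end

section \<open>Gluing block configurations\<close>

text \<open>In units of the block length, two blocks are separated by a gap of at least \<open>(1 - r)/r - 1\<close>
  (\<open>basic_interval_gap\<close>). If centroids keep the distance \<open>r\<^sup>2/2\<close> from the ends of their block, a centroid
  of a block to the right is therefore at least \<open>(1 - r)/r + r\<^sup>2/2\<close>, and one to the left is at most
  \<open>1 - (1 - r)/r - r\<^sup>2/2\<close>. The cell must stay on its side of the midpoint even for these
  extreme neighbours. This condition refers to one block only.\<close>

definition confined :: "real \<Rightarrow> nat list list \<Rightarrow> bool" where
  "confined r W \<longleftrightarrow> r\<^sup>2 / 2 \<le> centroid r W \<and> centroid r W \<le> 1 - r\<^sup>2 / 2 \<and>
     (\<forall>x\<in>cell r W. 2 * x \<le> centroid r W + (1 - r) / r + r\<^sup>2 / 2 \<and>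
                   centroid r W + 1 \<le> 2 * x + (1 - r) / r + r\<^sup>2 / 2)"

definition cells_separated :: "real \<Rightarrow> nat list list \<Rightarrow> nat list list \<Rightarrow> bool" where
  "cells_separated r V W \<longleftrightarrow> separated (centroid r V) (cell r V) (centroid r W) (cell r W)"

text \<open>The words of all cells together form a prefix code whose weights add up to 1. So the cells
  of a configuration exhaust the mass of the unit interval.\<close>

definition configuration :: "real \<Rightarrow> nat list list list \<Rightarrow> bool" where
  "configuration r Ws \<longleftrightarrow> [] \<notin> set Ws \<and> disjoint_words (concat Ws) \<and> weight (concat Ws) = 1 \<and>
     sorted_wrt (cells_separated r) Ws \<and> (\<forall>W\<in>set Ws. confined r W)"

lemma sorted_wrt_cases:
  "sorted_wrt R xs \<Longrightarrow> x \<in> set xs \<Longrightarrow> y \<in> set xs \<Longrightarrow> x \<noteq> y \<Longrightarrow> R x y \<or> R y x"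
  by (induction xs) auto

lemma configuration_distinct: "configuration r Ws \<Longrightarrow> distinct Ws"
proof -
  have "sorted_wrt (cells_separated r) Ws \<Longrightarrow> distinct Ws"
    by (induction Ws) (auto simp: cells_separated_def separated_def)
  then show "configuration r Ws \<Longrightarrow> distinct Ws" by (simp add: configuration_def)
qed

lemma disjoint_words_concat: "disjoint_words (concat Ws) \<Longrightarrow> W \<in> set Ws \<Longrightarrow> disjoint_words W"
  by (induction Ws) (auto simp: disjoint_words_def sorted_wrt_append)

lemma finite_wordset: "finite (wordset k)"
  using finite_lists_length_eq[of "{1, 2::nat}" k] by (simp add: wordset_def conj_commute)

lemma card_wordset: "card (wordset k) = 2 ^ k"
  using card_lists_length_eq[of "{1, 2::nat}" k]
  by (simp add: wordset_def conj_commute numeral_2_eq_2)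

lemma confined_separated:
  assumes r: "0 < r" "r < 1/2" and conf: "confined r V" "confined r W" and len: "length s = length t"
    and gap: "Sw r s 0 + r ^ length s * ((1 - r) / r) \<le> Sw r t 0"
  shows "separated (Sw r s (centroid r V)) (Sw r s ` cell r V) (Sw r t (centroid r W)) (Sw r t ` cell r W)"
proof -
  define c where "c = r ^ length s"
  define p q where "p = centroid r V" and "q = centroid r W"
  define g where "g = (1 - r) / r"
  define s0 t0 where "s0 = Sw r s 0" and "t0 = Sw r t 0"
  have c: "0 < c" using r by (simp add: c_def)
  have g: "1 < g" using r by (simp add: g_def pos_less_divide_eq)
  have S: "Sw r s x = c * x + s0" "Sw r t x = c * x + t0" for x
    using Sw_affine[of r s x] Sw_affine[of r t x] len by (simp_all add: c_def s0_def t0_def)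
  have gap': "s0 + c * g \<le> t0" using gap by (simp add: c_def g_def s0_def t0_def)
  have pq: "r\<^sup>2 / 2 \<le> p" "p \<le> 1 - r\<^sup>2 / 2" "r\<^sup>2 / 2 \<le> q" "q \<le> 1 - r\<^sup>2 / 2"
    using conf by (simp_all add: confined_def p_def q_def)
  have "p < q + g"
    using pq g zero_le_power2[of r] by linarith
  then have "c * p < c * (q + g)" using c by simp
  moreover have "c * (2 * x) \<le> c * (p + q + g)" if "x \<in> cell r V" for x
    using conf(1) that pq c by (intro mult_left_mono) (fastforce simp: confined_def p_def g_def)+
  moreover have "c * (p + q) \<le> c * (2 * y + g)" if "y \<in> cell r W" for y
    using conf(2) that pq c by (intro mult_left_mono) (fastforce simp: confined_def q_def g_def)+
  ultimately show ?thesis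
    using gap' unfolding separated_def p_def[symmetric] q_def[symmetric]
    by (force simp: S algebra_simps)
qed

text \<open>Within a block, separation is inherited from the unit interval by scaling. Between blocks it comes
  from confinement, so the configurations of different blocks can be chosen independently.\<close>

lemma (in cantor_measure) CVT_of_configurations:
  assumes D: "\<And>s. s \<in> wordset k \<Longrightarrow> configuration r (D s)"
  shows "CVT P (\<Sum>s\<in>wordset k. length (D s))
    (\<Union>s\<in>wordset k. (\<lambda>W. aw r P ((@) s ` set W)) ` set (D s))"
proof -
  define K where "K = (SIGMA s:wordset k. set (D s))"
  define shift where "shift = (\<lambda>(s, W). map ((@) s) W :: nat list list)"
  let ?a = "\<lambda>i. centroid r (shift i)" and ?C = "\<lambda>i. cell r (shift i)"
  have K: "W \<noteq> []" "disjoint_words W" "confined r W" "set s \<subseteq> {1, 2}" "length s = k"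
    if "(s, W) \<in> K" for s W
  proof -
    have s: "s \<in> wordset k" and W: "W \<in> set (D s)" using that by (auto simp: K_def)
    show "W \<noteq> []" "disjoint_words W" "confined r W"
      using D[OF s] W disjoint_words_concat[OF _ W] by (auto simp: configuration_def)
    show "set s \<subseteq> {1, 2}" "length s = k" using s by (auto simp: wordset_def)
  qed
  have dw: "disjoint_words (shift i)" and shift_ne: "shift i \<noteq> []" if "i \<in> K" for i
  proof -
    obtain s W where i: "i = (s, W)" by fastforce
    show "disjoint_words (shift i)"
      unfolding i shift_def prod.case using that[unfolded i] by (intro disjoint_words_shift K(2,4))
    show "shift i \<noteq> []"
      using K(1)[OF that[unfolded i]] by (simp add: i shift_def)
  qed
  have fin: "finite K" unfolding K_def by (intro finite_SigmaI finite_wordset) simp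
  have pos: "0 < measure P (?C i)" if "i \<in> K" for i
    using cell_moments[OF dw[OF that]] weight_pos[OF shift_ne[OF that]] by simp
  let ?B = "\<lambda>s. cell r (map ((@) s) (concat (D s)))"
  have block: "(\<Union>W\<in>set (D s). ?C (s, W)) = ?B s" for s
    by (simp only: cell_def shift_def prod.case set_map set_concat image_UN[of "(@) s"] UN_UN_flatten)
  have total: "measure P (\<Union>i\<in>K. ?C i) = 1"
  proof -
    have "(\<Union>i\<in>K. ?C i) = (\<Union>s\<in>wordset k. \<Union>W\<in>set (D s). ?C (s, W))"
      by (auto simp: K_def)
    also have "\<dots> = (\<Union>s\<in>wordset k. ?B s)"
      by (simp only: block)
    also have "measure P \<dots> = (\<Sum>s\<in>wordset k. measure P (?B s))"
    proof (rule finite_measure_finite_Union[OF finite_wordset])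
      show "disjoint_family_on ?B (wordset k)"
        unfolding disjoint_family_on_def
      proof (intro ballI impI)
        fix s t assume st: "s \<in> wordset k" "t \<in> wordset k" "s \<noteq> t"
        then have "s \<parallel> t"
          by (intro not_equal_is_parallel) (simp_all add: wordset_def)
        then have "J r s \<inter> J r t = {}"
          using st by (intro J_disjoint[OF r]) (auto simp: wordset_def)
        moreover have "?B s \<subseteq> J r s" for s
          unfolding cell_shift J_def by (intro image_mono cell_subset_unit)
        ultimately show "?B s \<inter> ?B t = {}"
          by (meson disjoint_iff subsetD)
      qed
      show "?B ` wordset k \<subseteq> sets P"
        by (auto intro: cell_borel)
    qed
    also have "\<dots> = (\<Sum>s\<in>wordset k. (1/2) ^ k)"
    proof (rule sum.cong)
      fix s assume s: "s \<in> wordset k"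
      then have "disjoint_words (map ((@) s) (concat (D s)))"
        using D by (intro disjoint_words_shift) (auto simp: configuration_def wordset_def)
      then have "measure P (?B s) = (1/2) ^ length s * weight (concat (D s))"
        using cell_moments by (simp only: weight_shift)
      then show "measure P (?B s) = (1/2) ^ k"
        using D[OF s] s by (simp add: configuration_def wordset_def)
    qed simp
    also have "\<dots> = 1" by (simp add: card_wordset power_one_over)
    finally show ?thesis .
  qed
  have sep: "separated (?a i) (?C i) (?a j) (?C j) \<or> separated (?a j) (?C j) (?a i) (?C i)"
    if ij: "i \<in> K" "j \<in> K" "i \<noteq> j" for i j
  proof -
    obtain s V t W where eq: "i = (s, V)" "j = (t, W)" by fastforce
    have a: "?a i = Sw r s (centroid r V)" "?a j = Sw r t (centroid r W)"
      and C: "?C i = Sw r s ` cell r V" "?C j = Sw r t ` cell r W"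
      using K(1)[OF ij(1)[unfolded eq]] K(1)[OF ij(2)[unfolded eq]]
      by (simp_all add: eq shift_def centroid_shift cell_shift)
    show ?thesis
    proof (cases "s = t")
      case True
      have "s \<in> wordset k" and VW: "V \<in> set (D s)" "W \<in> set (D s)" "V \<noteq> W"
        using ij True by (auto simp: eq K_def)
      then have "sorted_wrt (cells_separated r) (D s)"
        using D by (simp add: configuration_def)
      then have "cells_separated r V W \<or> cells_separated r W V"
        by (rule sorted_wrt_cases[OF _ VW])
      moreover have "0 < r ^ length t" using r by simp
      ultimately show ?thesis
        unfolding a C True cells_separated_def
        by (auto intro: separated_affine[OF _ _ Sw_affine])
    next
      case False
      have len: "length s = length t" using K(5) ij unfolding eq by metis
      have st: "set s \<subseteq> {1, 2}" "set t \<subseteq> {1, 2}" and conf: "confined r V" "confined r W"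
        using K(3,4) ij unfolding eq by blast+
      show ?thesis
        unfolding a C
        using basic_interval_gap[OF r len st False] confined_separated[OF r conf len]
          confined_separated[OF r conf(2,1) len[symmetric], folded len]
        by blast
    qed
  qed
  have "CVT P (card K) (?a ` K)"
  proof (rule CVT_of_separated_cells[where C = ?C, OF fin cell_borel pos _ total sep])
    show "?a i = cond_mean P (?C i)" if "i \<in> K" for i
      by (rule cond_mean_cell[OF dw[OF that], symmetric])
  qed
  moreover have "card K = (\<Sum>s\<in>wordset k. length (D s))"
  proof -
    have "card (set (D s)) = length (D s)" if "s \<in> wordset k" for s
      by (intro distinct_card configuration_distinct[of r] D that)
    then show ?thesis
      by (simp add: K_def finite_wordset)
  qed
  moreover have "?a ` K = (\<Union>s\<in>wordset k. (\<lambda>W. aw r P ((@) s ` set W)) ` set (D s))"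
  proof -
    have "?a (s, W) = aw r P ((@) s ` set W)" if "(s, W) \<in> K" for s W
      using aw_eq_centroid[OF dw[OF that]] by (simp only: shift_def prod.case set_map)
    then have "?a ` K = (\<lambda>i. aw r P ((@) (fst i) ` set (snd i))) ` K"
      by (intro image_cong refl) (metis prod.collapse)
    also have "\<dots> = (\<Union>s\<in>wordset k. (\<lambda>W. aw r P ((@) s ` set W)) ` set (D s))"
      by (simp only: K_def Sigma_def image_UN image_insert image_empty fst_conv snd_conv UNION_singleton_eq_range image_image)
    finally show ?thesis .
  qed
  ultimately show ?thesis by simp
qed

section \<open>The four block configurations\<close>

definition two_cells :: "nat list list list" where
  "two_cells = [[[1]], [[2]]]"

definition three_cells_left :: "nat list list list" where
  "three_cells_left = [[[1,1], [1,2,1], [1,2,2,1]], [[1,2,2,2], [2,1]], [[2,2]]]"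

definition three_cells_right :: "nat list list list" where
  "three_cells_right = [[[1,1]], [[1,2], [2,1,1,1]], [[2,1,1,2], [2,1,2], [2,2]]]"

definition four_cells :: "nat list list list" where
  "four_cells = [[[1,1]], [[1,2]], [[2,1]], [[2,2]]]"

lemmas cells_defs = two_cells_def three_cells_left_def three_cells_right_def four_cells_def

text \<open>The two expressions are the difference quotients between \<open>x\<close> and \<open>y\<close> of the polynomials
  \<open>69 t\<^sup>4 + 14 t\<^sup>2 - 76 t + 28\<close> and \<open>t\<^sup>4 + 21 t\<^sup>2 - 14 t + 2\<close>.\<close>

lemma difference_quotient_signs:
  fixes x y :: real
  assumes "x \<in> {43/100..46/100}" "y \<in> {43/100..46/100}"
  shows "69 * ((x + y) * (x\<^sup>2 + y\<^sup>2)) + 14 * (x + y) - 76 \<le> 0"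
    and "0 \<le> (x + y) * (x\<^sup>2 + y\<^sup>2) + 21 * (x + y) - 14"
proof -
  define u z where "u = x + y" and "z = (x + y) * (x\<^sup>2 + y\<^sup>2)"
  have "x\<^sup>2 \<le> (46/100)\<^sup>2" "y\<^sup>2 \<le> (46/100)\<^sup>2" using assms by (auto intro!: power_mono)
  then have "x\<^sup>2 + y\<^sup>2 \<le> 1/2" by (simp add: power2_eq_square)
  then have "z \<le> 1 * (1/2)" unfolding z_def using assms by (intro mult_mono) auto
  then have z: "z \<le> 1/2" "0 \<le> z" unfolding z_def using assms by auto
  have u: "86/100 \<le> u" "u \<le> 92/100" unfolding u_def using assms by auto
  show "69 * ((x + y) * (x\<^sup>2 + y\<^sup>2)) + 14 * (x + y) - 76 \<le> 0"
    unfolding u_def[symmetric] z_def[symmetric, folded u_def] using z u by linarith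
  show "0 \<le> (x + y) * (x\<^sup>2 + y\<^sup>2) + 21 * (x + y) - 14"
    unfolding u_def[symmetric] z_def[symmetric, folded u_def] using z u by linarith
qed

text \<open>On \<open>[0.43, 0.46]\<close> the first polynomial decreases and the second increases, so \<open>r\<close> lies on the
  side of each root where the corresponding inequality holds.\<close>

lemma root_inequalities:
  fixes r rminus rplus :: real
  assumes "0.43 < rminus" "rminus < 0.44"
    and qm: "69 * rminus ^ 4 + 14 * rminus ^ 2 - 76 * rminus + 28 = 0"
    and "0.45 < rplus" "rplus < 0.46"
    and pp: "rplus ^ 4 + 21 * rplus ^ 2 - 14 * rplus + 2 = 0"
    and "rminus \<le> r" "r \<le> rplus"
  shows "69 * r ^ 4 + 14 * r ^ 2 - 76 * r + 28 \<le> 0" "r ^ 4 + 21 * r ^ 2 - 14 * r + 2 \<le> 0"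
proof -
  have "69 * r ^ 4 + 14 * r ^ 2 - 76 * r + 28 - (69 * rminus ^ 4 + 14 * rminus ^ 2 - 76 * rminus + 28)
      = (r - rminus) * (69 * ((r + rminus) * (r\<^sup>2 + rminus\<^sup>2)) + 14 * (r + rminus) - 76)"
    by algebra
  also have "\<dots> \<le> 0"
  proof (rule mult_nonneg_nonpos)
    have "r \<in> {43/100..46/100}" "rminus \<in> {43/100..46/100}" using assms by auto
    from difference_quotient_signs[OF this] show "69 * ((r + rminus) * (r\<^sup>2 + rminus\<^sup>2)) + 14 * (r + rminus) - 76 \<le> 0"
      by blast
  qed (use assms in simp)
  finally show "69 * r ^ 4 + 14 * r ^ 2 - 76 * r + 28 \<le> 0" using qm by simp
  have "rplus ^ 4 + 21 * rplus ^ 2 - 14 * rplus + 2 - (r ^ 4 + 21 * r ^ 2 - 14 * r + 2)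
      = (rplus - r) * ((rplus + r) * (rplus\<^sup>2 + r\<^sup>2) + 21 * (rplus + r) - 14)"
    by algebra
  also have "\<dots> \<ge> 0"
  proof (rule mult_nonneg_nonneg)
    have "rplus \<in> {43/100..46/100}" "r \<in> {43/100..46/100}" using assms by auto
    from difference_quotient_signs[OF this] show "0 \<le> (rplus + r) * (rplus\<^sup>2 + r\<^sup>2) + 21 * (rplus + r) - 14"
      by blast
  qed (use assms in simp)
  finally show "r ^ 4 + 21 * r ^ 2 - 14 * r + 2 \<le> 0" using pp by simp
qed

lemma confinedI:
  assumes "0 < r" "r < 1/2" "c = centroid r W" "r\<^sup>2 / 2 \<le> c" "c \<le> 1 - r\<^sup>2 / 2" "g \<le> (1 - r) / r"
    and "\<forall>w\<in>set W. 2 * Sw r w 1 \<le> c + g + r\<^sup>2 / 2 \<and> c + 1 \<le> 2 * Sw r w 0 + g + r\<^sup>2 / 2"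
  shows "confined r W"
  using assms by (force simp: confined_def cell_def J_eq_interval)

lemma cells_separatedI:
  assumes "0 < r" "r < 1/2" "c = centroid r V" "d = centroid r W" "c < d"
    and "\<forall>w\<in>set V. 2 * Sw r w 1 \<le> c + d" "\<forall>w\<in>set W. c + d \<le> 2 * Sw r w 0"
  shows "cells_separated r V W"
  using assms by (force simp: cells_separated_def separated_def cell_def J_eq_interval)

lemma centroid_values:
  "centroid r [[1]] = r / 2"
  "centroid r [[2]] = 1 - r / 2"
  "centroid r [[1,1]] = r\<^sup>2 / 2"
  "centroid r [[1,2]] = r - r\<^sup>2 / 2"
  "centroid r [[2,1]] = 1 - r + r\<^sup>2 / 2"
  "centroid r [[2,2]] = 1 - r\<^sup>2 / 2"
  "centroid r [[1,1], [1,2,1], [1,2,2,1]] = 3/7 * r + 1/14 * r ^ 4"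
  "centroid r [[1,2,2,2], [2,1]] = 4/5 - 3/5 * r + 2/5 * r\<^sup>2 - 1/10 * r ^ 4"
  "centroid r [[1,2], [2,1,1,1]] = 1/5 + 3/5 * r - 2/5 * r\<^sup>2 + 1/10 * r ^ 4"
  "centroid r [[2,1,1,2], [2,1,2], [2,2]] = 1 - 3/7 * r - 1/14 * r ^ 4"
  by (simp_all add: centroid_def weight_def simil_def field_simps power2_eq_square power4_eq_xxxx)

lemma Sw_values:
  fixes r :: real
  shows "Sw r [1] x = r * x" "Sw r [2] x = 1 - r + r * x"
  "Sw r [1,1] x = r\<^sup>2 * x" "Sw r [1,2] x = r - r\<^sup>2 + r\<^sup>2 * x"
  "Sw r [2,1] x = 1 - r + r\<^sup>2 * x" "Sw r [2,2] x = 1 - r\<^sup>2 + r\<^sup>2 * x"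
  "Sw r [1,2,1] x = r - r\<^sup>2 + r ^ 3 * x" "Sw r [2,1,2] x = 1 - r + r\<^sup>2 - r ^ 3 + r ^ 3 * x"
  "Sw r [1,2,2,1] x = r - r ^ 3 + r ^ 4 * x" "Sw r [1,2,2,2] x = r - r ^ 4 + r ^ 4 * x"
  "Sw r [2,1,1,1] x = 1 - r + r ^ 4 * x" "Sw r [2,1,1,2] x = 1 - r + r ^ 3 - r ^ 4 + r ^ 4 * x"
  by (simp_all add: simil_def algebra_simps power2_eq_square power3_eq_cube power4_eq_xxxx)

text \<open>The configuration of the left type has two inner midpoints. The first one stays left of
  \<open>J r [1,2,2,2]\<close> exactly if \<open>69 r\<^sup>4 + 14 r\<^sup>2 - 76 r + 28 \<le> 0\<close>, and the second one stays right of
  \<open>J r [2,1]\<close> exactly if \<open>r\<^sup>4 + 21 r\<^sup>2 - 14 r + 2 \<le> 0\<close>. The configuration of the right type is its mirror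
  image. All other conditions have slack: the first midpoint stays right of \<open>J r [1,2,2,1]\<close>
  as long as \<open>r \<le> 0.452\<close>, and the rest is settled by crude bounds on the powers of \<open>r\<close>.\<close>

lemma configurations:
  fixes r :: real
  assumes r43: "43/100 \<le> r"
    and q: "69 * r ^ 4 + 14 * r\<^sup>2 - 76 * r + 28 \<le> 0"
    and p: "r ^ 4 + 21 * r\<^sup>2 - 14 * r + 2 \<le> 0"
  shows "configuration r two_cells" "configuration r three_cells_left"
    "configuration r three_cells_right" "configuration r four_cells"
proof -
  have pow_ge: "(43/100) ^ n \<le> r ^ n" for n using r43 by (intro power_mono) auto
  \<comment> \<open>The root of the second polynomial near \<open>0.4512\<close> is below \<open>0.4515\<close>.\<close>
  have r4515: "r \<le> 4515/10000"
  proof (rule ccontr)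
    assume "\<not> r \<le> 4515/10000"
    then have "(4515/10000) ^ 4 \<le> r ^ 4" by (intro power_mono) auto
    then have "415/10000 \<le> r ^ 4" by (simp add: power4_eq_xxxx)
    moreover have "0 \<le> (r - 4515/10000) * (21 * (r - 4515/10000) + 4963/1000)"
      using \<open>\<not> r \<le> 4515/10000\<close> by (intro mult_nonneg_nonneg) auto
    moreover have "(r - 4515/10000) * (21 * (r - 4515/10000) + 4963/1000) = 21 * r\<^sup>2 - 14 * r + 204010275/100000000"
      by (simp add: power2_eq_square field_simps)
    ultimately show False using p by linarith
  qed
  have pow_le: "r ^ n \<le> (4515/10000) ^ n" for n using r43 r4515 by (intro power_mono) auto
  have r2: "1849/10000 \<le> r\<^sup>2" "r\<^sup>2 \<le> 2039/10000" and r3: "795/10000 \<le> r ^ 3" "r ^ 3 \<le> 921/10000"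
    and r4: "341/10000 \<le> r ^ 4" "r ^ 4 \<le> 416/10000"
    using pow_ge[of 2] pow_le[of 2] pow_ge[of 3] pow_le[of 3] pow_ge[of 4] pow_le[of 4]
    by (simp_all add: power2_eq_square power3_eq_cube power4_eq_xxxx)
  \<comment> \<open>This is the condition at \<open>J r [1,2,2,1]\<close>. At \<open>0.4515\<close> the value is about \<open>-0.03\<close>. Tangents there bound \<open>r\<^sup>2\<close> and \<open>r ^ 3\<close> from below.\<close>
  have slack: "71 * r ^ 4 - 70 * r ^ 3 - 14 * r\<^sup>2 + 76 * r - 28 \<le> 0"
  proof -
    have "(r - 4515/10000)\<^sup>2 = r\<^sup>2 - 903/1000 * r + 20385225/100000000"
      by (simp add: power2_eq_square field_simps)
    moreover have "(r - 4515/10000)\<^sup>2 * (r + 903/1000) = r ^ 3 - 61155675/100000000 * r + 18407858175/100000000000"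
      by (simp add: power2_eq_square power3_eq_cube field_simps)
    moreover have "0 \<le> (r - 4515/10000)\<^sup>2 * (r + 903/1000)"
      using r43 by (intro mult_nonneg_nonneg) auto
    moreover have "4515/10000 * r ^ 3 - r ^ 4 = r ^ 3 * (4515/10000 - r)"
      by (simp add: power3_eq_cube power4_eq_xxxx field_simps)
    moreover have "0 \<le> r ^ 3 * (4515/10000 - r)"
      using r43 r4515 by (intro mult_nonneg_nonneg) auto
    ultimately show ?thesis
      using zero_le_power2[of "r - 4515/10000"] r4515 by linarith
  qed
  \<comment> \<open>The distance \<open>(1 - r)/r\<close> of neighbouring blocks enters the remaining conditions only through this bound.\<close>
  have g: "121/100 \<le> (1 - r) / r" using r43 r4515 by (simp add: pos_le_divide_eq)
  have r: "0 < r" "r < 1/2" using r43 r4515 by auto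
  note bounds = r43 r4515 r2 r3 r4 p q slack
  note intros = confinedI[OF r refl _ _ g] cells_separatedI[OF r refl refl]
  have words: "disjoint_words (concat Ws) \<and> weight (concat Ws) = 1 \<and> [] \<notin> set Ws"
    if "Ws \<in> {two_cells, three_cells_left, three_cells_right, four_cells}" for Ws
    using that by (elim insertE) (simp_all add: cells_defs disjoint_words_def parallel_def weight_def)
  have two: "sorted_wrt (cells_separated r) two_cells \<and> (\<forall>W\<in>set two_cells. confined r W)"
    by (simp add: two_cells_def; intro conjI intros;
        simp add: centroid_values[unfolded One_nat_def] Sw_values[unfolded One_nat_def] del: Sw.simps;
        (intro conjI)?; use bounds in linarith)
  have left: "sorted_wrt (cells_separated r) three_cells_left \<and> (\<forall>W\<in>set three_cells_left. confined r W)"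
    by (simp add: three_cells_left_def; intro conjI intros;
        simp add: centroid_values[unfolded One_nat_def] Sw_values[unfolded One_nat_def] del: Sw.simps;
        (intro conjI)?; use bounds in linarith)
  have right: "sorted_wrt (cells_separated r) three_cells_right \<and> (\<forall>W\<in>set three_cells_right. confined r W)"
    by (simp add: three_cells_right_def; intro conjI intros;
        simp add: centroid_values[unfolded One_nat_def] Sw_values[unfolded One_nat_def] del: Sw.simps;
        (intro conjI)?; use bounds in linarith)
  have four: "sorted_wrt (cells_separated r) four_cells \<and> (\<forall>W\<in>set four_cells. confined r W)"
    by (simp add: four_cells_def; intro conjI intros;
        simp add: centroid_values[unfolded One_nat_def] Sw_values[unfolded One_nat_def] del: Sw.simps;
        (intro conjI)?; use bounds in linarith)
  show "configuration r two_cells" "configuration r three_cells_left"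
    "configuration r three_cells_right" "configuration r four_cells"
    unfolding configuration_def using words two left right four by simp_all
qed

section \<open>Counting the points\<close>

lemma ell_eqI:
  assumes "2 ^ l < n" "n < 2 ^ (l + 1)"
  shows "ell n = l"
  unfolding ell_def
proof (rule the_equality)
  fix m assume m: "2 ^ m < n \<and> n < 2 ^ (m + 1)"
  have "2 ^ m < (2::nat) ^ (l + 1)" "2 ^ l < (2::nat) ^ (m + 1)" using m assms by linarith+
  then have "m < l + 1" "l < m + 1"
    by (simp_all only: power_strict_increasing_iff[of "2::nat"] one_less_numeral_iff semiring_norm)
  then show "m = l" by simp
qed (use assms in simp)

lemma ell_bounds:
  assumes "n \<ge> 2" "\<not> (\<exists>l::nat. n = 2 ^ l)"
  shows "2 ^ ell n < n" "n < 2 ^ (ell n + 1)" "1 \<le> ell n"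
proof -
  obtain l where l: "2 ^ l \<le> n" "n < 2 ^ (l + 1)"
    using ex_power_ivl1[of 2 n] assms by auto
  then have "2 ^ l < n" using assms by (metis le_neq_implies_less)
  with l have "ell n = l" by (intro ell_eqI)
  with l \<open>2 ^ l < n\<close> show "2 ^ ell n < n" "n < 2 ^ (ell n + 1)" by auto
  show "1 \<le> ell n"
  proof (rule ccontr)
    assume "\<not> 1 \<le> ell n"
    then have "ell n = 0" by simp
    then have "n < 2" using \<open>n < 2 ^ (ell n + 1)\<close> by simp
    then show False using assms by simp
  qed
qed

lemma (in cantor_measure) aw_singleton:
  assumes "set w \<subseteq> {1, 2}"
  shows "aw r P {w} = Sw r w (1/2)"
  using aw_eq_centroid[of "[w]"] assms
  by (simp add: disjoint_words_def centroid_def weight_def)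

lemma sum_if_subset_const:
  assumes "finite W" "I \<subseteq> W"
  shows "(\<Sum>s\<in>W. if s \<in> I then a else b) = card I * a + (card W - card I) * (b::nat)"
proof -
  have "(\<Sum>s\<in>W. if s \<in> I then a else b) = (\<Sum>s\<in>I. a) + (\<Sum>s\<in>W - I. b)"
    using assms by (subst sum.If_cases) (auto simp: Int_absorb1 Diff_eq)
  then show ?thesis using assms by (simp add: card_Diff_subset finite_subset)
qed

theorem lemma3p13:
  fixes r rminus rplus :: real and P :: "real measure" and n :: nat
    and A :: "nat list \<Rightarrow> real set" and I :: "nat list set"
  assumes "0.43 < rminus" "rminus < 0.44"
    and "69 * rminus ^ 4 + 14 * rminus ^ 2 - 76 * rminus + 28 = 0"
    and "0.45 < rplus" "rplus < 0.46"
    and "rplus ^ 4 + 21 * rplus ^ 2 - 14 * rplus + 2 = 0"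
    and "rminus \<le> r" "r \<le> rplus"
    and "cantor_prob r P"
    and "n \<ge> 2" "\<not> (\<exists>l::nat. n = 2 ^ l)"
    and "admissible n I"
    and "\<And>s. set s \<subseteq> {1, 2} \<Longrightarrow> A s = A_fst r P s \<or> A s = A_snd r P s"
  shows "CVT P n (alpha r A n I)"
proof -
  have "43/100 \<le> r" "r \<le> 46/100" using assms by simp_all
  note conf = configurations[OF this(1) root_inequalities[OF assms(1-8)]]
  interpret cantor_measure r P
    using \<open>43/100 \<le> r\<close> \<open>r \<le> 46/100\<close> assms(9) by unfold_locales auto
  define k where "k = ell n - 1"
  have ell: "2 * 2 ^ k < n" "n < 4 * 2 ^ k" "2 ^ ell n = 2 * (2::nat) ^ k"
  proof -
    have "ell n = Suc k" using ell_bounds(3)[OF assms(10,11)] by (simp add: k_def)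
    then show "2 * 2 ^ k < n" "n < 4 * 2 ^ k" "2 ^ ell n = 2 * (2::nat) ^ k"
      using ell_bounds[OF assms(10,11)] by simp_all
  qed
  have I: "I \<subseteq> wordset k"
    and card_I: "card I = (if n \<le> 3 * 2 ^ k then n - 2 * 2 ^ k else n - 3 * 2 ^ k)"
    using assms(12) ell by (simp_all add: admissible_def k_def)
  have I_le: "card I \<le> 2 ^ k"
    using card_mono[OF finite_wordset I] by (simp add: card_wordset)
  define pts where "pts = (\<lambda>s Ws. (\<lambda>W. aw r P ((@) s ` set W)) ` set Ws)"
  \<comment> \<open>If the two candidates for \<open>A s\<close> coincide as sets, either configuration describes \<open>A s\<close>.\<close>
  define B where "B s = (if A s = A_fst r P s then three_cells_left else three_cells_right)" for s
  have B: "configuration r (B s)" "length (B s) = 3" for s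
    using conf by (simp_all add: B_def cells_defs)
  have pts_B: "pts s (B s) = A s" if "s \<in> wordset k" for s
    using assms(13)[of s] that
    by (auto simp: wordset_def B_def pts_def cells_defs A_fst_def A_snd_def)
  have pts_two: "pts s two_cells = {Sw r (s @ [1]) (1/2), Sw r (s @ [2]) (1/2)}" if "s \<in> wordset k" for s
    using that aw_singleton[of "s @ [1]"] aw_singleton[of "s @ [2]"]
    by (simp add: wordset_def pts_def cells_defs)
  have wordset2: "wordset 2 = {[1,1], [1,2], [2,1], [2,2]}"
    by (auto simp: wordset_def length_Suc_conv numeral_2_eq_2)
  have pts_four: "pts s four_cells = (\<lambda>t. Sw r (s @ t) (1/2)) ` wordset 2" if "s \<in> wordset k" for s
    using that aw_singleton[of "s @ [1,1]"] aw_singleton[of "s @ [1,2]"]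
      aw_singleton[of "s @ [2,1]"] aw_singleton[of "s @ [2,2]"]
    by (simp add: wordset_def[of k] wordset2 pts_def cells_defs)
  show ?thesis
  proof (cases "n \<le> 3 * 2 ^ k")
    case True
    define D where "D s = (if s \<in> I then B s else two_cells)" for s
    have "CVT P (\<Sum>s\<in>wordset k. length (D s)) (\<Union>s\<in>wordset k. pts s (D s))"
      unfolding pts_def by (rule CVT_of_configurations) (simp add: D_def B conf)
    moreover have "length (D s) = (if s \<in> I then 3 else 2)" for s
      by (simp add: D_def B two_cells_def)
    then have "(\<Sum>s\<in>wordset k. length (D s)) = n"
      using sum_if_subset_const[OF finite_wordset I, of 3 2] card_I True I_le ell
      by (simp add: card_wordset)
    moreover have "(\<Union>s\<in>wordset k. pts s (D s)) =
        (\<Union>s\<in>I. pts s (D s)) \<union> (\<Union>s\<in>wordset k - I. pts s (D s))"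
      using I by blast
    then have "(\<Union>s\<in>wordset k. pts s (D s)) = alpha r A n I"
      unfolding alpha_def k_def[symmetric] using True I pts_B pts_two by (simp add: D_def subset_iff)
    ultimately show ?thesis by simp
  next
    case False
    define D where "D s = (if s \<in> I then four_cells else B s)" for s
    have cvt: "CVT P (\<Sum>s\<in>wordset k. length (D s)) (\<Union>s\<in>wordset k. pts s (D s))"
      unfolding pts_def by (rule CVT_of_configurations) (simp add: D_def B conf)
    have "length (D s) = (if s \<in> I then 4 else 3)" for s
      by (simp add: D_def B four_cells_def)
    then have count: "(\<Sum>s\<in>wordset k. length (D s)) = n"
      using sum_if_subset_const[OF finite_wordset I, of 4 3] card_I False I_le ell
      by (simp add: card_wordset)
    have "(\<Union>s\<in>wordset k. pts s (D s)) =
        (\<Union>s\<in>wordset k - I. pts s (D s)) \<union> (\<Union>s\<in>I. pts s (D s))"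
      using I by blast
    then have "(\<Union>s\<in>wordset k. pts s (D s)) =
        (\<Union>s\<in>wordset k - I. A s) \<union> (\<Union>s\<in>I. (\<lambda>t. Sw r (s @ t) (1/2)) ` wordset 2)"
      using I pts_B pts_four by (simp add: D_def subset_iff)
    moreover have "(\<Union>s\<in>I. (\<lambda>t. Sw r (s @ t) (1/2)) ` wordset 2) =
        {Sw r (s @ t) (1/2) | s t. s \<in> I \<and> t \<in> wordset 2}"
      by blast
    ultimately have "(\<Union>s\<in>wordset k. pts s (D s)) = alpha r A n I"
      unfolding alpha_def k_def[symmetric] using False by simp
    with cvt count show ?thesis by simp
  qed
qed

end
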